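(* Let $\mathcal F$ and $\mathcal G$ be MaxSAT formulas (with positive weights) such that $\mathcal F\models\mathcal G$, and let $\mathcal F;\mathcal F_1;\dots;\mathcal F_i$ be any sequence of $\mathbf{ResSV}$ rule applications starting at $\mathcal F$ (the formula $\mathcal F_i$ may contain clauses with negative weight). Then there is a proof $\mathcal F_i\vdash_{\mathbf{ResSV}}\mathcal G$, i.e., a $\mathbf{ResSV}$ proof $\mathcal F_i;\dots;\mathcal H$ with $\mathcal G\subseteq\mathcal H$ and all clauses of $\mathcal H$ having positive weight.
   Context: A literal is a Boolean variable $x$ or its negation $\overline x$; a clause is a disjunction of literals ($\Box$ is the empty clause). Weights are elements of $\mathbb{R}_{>0}\cup\{\infty\}$ with $\infty+w=\infty-w=\infty$; during $\mathbf{ResSV}$ proofs clauses may also carry finite negative weights. A MaxSAT formula is a finite collection of weighted clauses $(C,w)$, where $(C,u),(C,v)$ may be merged into $(C,u+v)$ and conversely, and clauses of weight $0$ disappear. The cost $\mathcal F(X)$ of a truth assignment $X$ is the sum of weights of clauses falsified by $X$; $\mathcal F\models\mathcal G$ means $\mathcal F(X)\ge\mathcal G(X)$ for all $X$. $\mathcal G\subseteq\mathcal F$ means every $(C,w)\in\mathcal G$ has some $(C,w')\in\mathcal F$ with $w\le w'$. A MaxSAT inference rule replaces its antecedents in the current formula by its consequents. $\mathbf{ResSV}$ has three rules. Resolution: from $(x\lor A,v),(\overline x\lor B,w)$ with $v,w$ positive ($A,B$ possibly empty disjunctions), with $m=\min\{v,w\}$, derive $(A\lor B,m),(x\lor A,v-m),(\overline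 x\lor B,w-m),(x\lor A\lor\overline B,m),(\overline x\lor B\lor\overline A,m)$, where for $D=l_1\lor\dots\lor l_p$ the expression $(E\lor\overline D,u)$ stands for $(E\lor\overline{l_1},u),(E\lor l_1\lor\overline{l_2},u),\dots,(E\lor l_1\lor\dots\lor l_{p-1}\lor\overline{l_p},u)$ (nothing if $D$ is empty), and tautologies are discarded. Split: from $(A,w)$ with $w$ positive derive $(A\lor x,w),(A\lor\overline x,w)$. Virtual: with no antecedents, introduce $(A,w)$ and $(A,-w)$ for any clause $A$ and finite $w$. *)

theory Defs
  imports "HOL-Library.Extended_Real"
begin

datatype 'v literal = Pos 'v | Neg 'v

fun neg :: "'v literal \<Rightarrow> 'v literal" where
  "neg (Pos x) = Neg x"
| "neg (Neg x) = Pos x"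

type_synonym 'v clause = "'v literal set"

definition tautology :: "'v clause \<Rightarrow> bool" where
  "tautology C \<longleftrightarrow> (\<exists>l \<in> C. neg l \<in> C)"

type_synonym 'v assignment = "'v \<Rightarrow> bool"

fun lit_true :: "'v assignment \<Rightarrow> 'v literal \<Rightarrow> bool" where
  "lit_true X (Pos x) = X x"
| "lit_true X (Neg x) = (\<not> X x)"

definition falsifies :: "'v assignment \<Rightarrow> 'v clause \<Rightarrow> bool" where
  "falsifies X C \<longleftrightarrow> (\<forall>l \<in> C. \<not> lit_true X l)"

text \<open>
  A collection of weighted clauses, taken up to merging and unmerging of equal clauses and
  deletion of weight 0, is the function giving each clause its total weight (0 if absent).
  On \<^typ>\<open>ereal\<close>, \<open>\<infinity> + w = \<infinity> - w = \<infinity>\<close> holds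
  for every \<open>w\<close>, including \<open>\<infinity> - \<infinity> = \<infinity>\<close>.
\<close>

type_synonym 'v formula = "'v clause \<Rightarrow> ereal"

definition clauses_of :: "'v formula \<Rightarrow> 'v clause set" where
  "clauses_of F = {C. F C \<noteq> 0}"

definition weighted_formula :: "'v formula \<Rightarrow> bool" where
  "weighted_formula F \<longleftrightarrow> finite (clauses_of F) \<and>
     (\<forall>C \<in> clauses_of F. finite C \<and> \<not> tautology C \<and> F C \<noteq> -\<infinity>)"

definition maxsat_formula :: "'v formula \<Rightarrow> bool" where
  "maxsat_formula F \<longleftrightarrow> weighted_formula F \<and> (\<forall>C \<in> clauses_of F. F C > 0)"

definition cost :: "'v formula \<Rightarrow> 'v assignment \<Rightarrow> ereal" where
  "cost F X = (\<Sum>C | C \<in> clauses_of F \<and> falsifies X C. F C)"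

definition entails :: "'v formula \<Rightarrow> 'v formula \<Rightarrow> bool" where
  "entails F G \<longleftrightarrow> (\<forall>X. cost F X \<ge> cost G X)"

definition subformula :: "'v formula \<Rightarrow> 'v formula \<Rightarrow> bool" where
  "subformula G F \<longleftrightarrow> (\<forall>C \<in> clauses_of G. C \<in> clauses_of F \<and> G C \<le> F C)"

text \<open>Equal clauses are merged, and tautologies are discarded.\<close>

definition formula_of :: "('v clause \<times> ereal) list \<Rightarrow> 'v formula" where
  "formula_of ws C = (if tautology C then 0 else (\<Sum>(D, w) \<leftarrow> ws. if D = C then w else 0))"

text \<open>
  \<open>or_not E D u\<close> is the list abbreviated as \<open>(E \<or> not D, u)\<close>; it depends on the order
  in which the literals of the disjunction \<open>D\<close> are written, so \<open>D\<close> is a list.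
\<close>

fun or_not :: "'v clause \<Rightarrow> 'v literal list \<Rightarrow> ereal \<Rightarrow> ('v clause \<times> ereal) list" where
  "or_not E [] u = []"
| "or_not E (l # D) u = (insert (neg l) E, u) # or_not (insert l E) D u"

inductive ressv_rule :: "('v clause \<times> ereal) list \<Rightarrow> ('v clause \<times> ereal) list \<Rightarrow> bool" where
  resolution:
    "v > 0 \<Longrightarrow> w > 0 \<Longrightarrow> m = min v w \<Longrightarrow>
     ressv_rule
       [(insert (Pos x) (set A), v), (insert (Neg x) (set B), w)]
       ([(set A \<union> set B, m), (insert (Pos x) (set A), v - m), (insert (Neg x) (set B), w - m)]
        @ or_not (insert (Pos x) (set A)) B m
        @ or_not (insert (Neg x) (set B)) A m)"
| split:
    "w > 0 \<Longrightarrow> ressv_rule [(A, w)] [(insert (Pos x) A, w), (insert (Neg x) A, w)]"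
| virtual:
    "finite A \<Longrightarrow> ressv_rule [] [(A, ereal w), (A, - ereal w)]"

text \<open>
  \<open>R\<close> is what remains of the current formula once the antecedents are singled out. It may
  have negative weights: a clause of weight \<open>u\<close> may be unmerged as \<open>u = r + v\<close>
  with \<open>v > 0\<close> used as antecedent and \<open>r < 0\<close>.
\<close>

inductive ressv_step :: "'v formula \<Rightarrow> 'v formula \<Rightarrow> bool" where
  "weighted_formula R \<Longrightarrow> ressv_rule ants cons \<Longrightarrow> \<forall>(C, w) \<in> set ants. \<not> tautology C \<Longrightarrow>
   ressv_step (\<lambda>C. R C + formula_of ants C) (\<lambda>C. R C + formula_of cons C)"

abbreviation ressv_derivation :: "'v formula \<Rightarrow> 'v formula \<Rightarrow> bool" where
  "ressv_derivation \<equiv> ressv_step\<^sup>*\<^sup>*"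

definition ressv_proves :: "'v formula \<Rightarrow> 'v formula \<Rightarrow> bool" where
  "ressv_proves F G \<longleftrightarrow> (\<exists>H. ressv_derivation F H \<and> subformula G H \<and> maxsat_formula H)"

end

theory Submission
  imports Defs
begin

text \<open>
  Every rule preserves the cost function. Conversely, for a finite weight \<open>r\<close> of either
  sign, \<open>(A, r)\<close> may be exchanged for \<open>(A \<or> x, r), (A \<or> not x, r)\<close>: for \<open>r > 0\<close> this is a
  split, and for \<open>r < 0\<close> it is the resolution of the two extensions, all of whose other
  consequents are tautologies or have weight 0. Infinite weights can be propagated from \<open>A\<close> to
  its two extensions and cancel without ever being consumed, so take a derivable formula with as
  many infinite clauses as possible; then a clause is infinite iff all the full clauses above it
  are. Now move every finite weight to the full clauses and pull the finite part of \<open>G\<close> out of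
  them. What remains on a finite full clause is the difference of the costs of \<open>F\<close> and \<open>G\<close> at
  the assignment falsifying it, hence is nonnegative.
\<close>

section \<open>Soundness\<close>

text \<open>Clauses outside \<open>clauses_of F\<close> have weight 0, so the costs of different
  formulas can be summed over one common finite set.\<close>

lemma cost_superset:
  assumes "finite S" "clauses_of F \<subseteq> S"
  shows "cost F X = (\<Sum>C\<in>S. if falsifies X C then F C else 0)"
proof -
  have "cost F X = (\<Sum>C | C \<in> S \<and> falsifies X C. F C)"
    unfolding cost_def using assms
    by (intro sum.mono_neutral_left) (auto simp: clauses_of_def)
  also have "\<dots> = (\<Sum>C\<in>S. if falsifies X C then F C else 0)"
    using assms(1) by (simp add: sum.inter_filter)
  finally show ?thesis .
qed

lemma cost_add:
  assumes "finite (clauses_of F)" "finite (clauses_of G)"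
  shows "cost (\<lambda>C. F C + G C) X = cost F X + cost G X"
proof -
  let ?S = "clauses_of F \<union> clauses_of G"
  have "clauses_of (\<lambda>C. F C + G C) \<subseteq> ?S"
    by (auto simp: clauses_of_def)
  then show ?thesis
    using assms
    by (simp add: cost_superset[of ?S] sum.distrib[symmetric] if_distrib cong: if_cong)
qed

text \<open>This is why discarding tautologies leaves every cost unchanged.\<close>

lemma falsifies_not_tautology: "falsifies X C \<Longrightarrow> \<not> tautology C"
proof
  assume X: "falsifies X C" and "tautology C"
  then obtain l where "l \<in> C" "neg l \<in> C" by (auto simp: tautology_def)
  then have "\<not> lit_true X l" "\<not> lit_true X (neg l)" using X by (auto simp: falsifies_def)
  then show False by (cases l) auto
qed

section \<open>Formulas given by lists of weighted clauses, and their costs\<close>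

lemma formula_of_Nil: "formula_of [] = (\<lambda>C. 0)"
  by (auto simp: formula_of_def)

lemma formula_of_Cons:
  "formula_of ((D, w) # ws) = (\<lambda>C. (if C = D \<and> \<not> tautology D then w else 0) + formula_of ws C)"
  by (auto simp: formula_of_def fun_eq_iff)

lemma formula_of_append:
  "formula_of (us @ ws) = (\<lambda>C. formula_of us C + formula_of ws C)"
  by (auto simp: formula_of_def fun_eq_iff)

lemma clauses_of_formula_of: "clauses_of (formula_of ws) \<subseteq> {C \<in> fst ` set ws. \<not> tautology C}"
proof (induction ws)
  case Nil
  then show ?case by (auto simp: clauses_of_def formula_of_Nil)
next
  case (Cons a ws)
  then show ?case
    by (cases a) (auto simp: clauses_of_def formula_of_Cons split: if_splits)
qed

lemma finite_clauses_of_formula_of: "finite (clauses_of (formula_of ws))"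
  by (rule finite_subset[OF clauses_of_formula_of]) auto

lemma cost_formula_of:
  "cost (formula_of ws) X = (\<Sum>(D, w) \<leftarrow> ws. if falsifies X D then w else 0)"
proof (induction ws)
  case Nil
  then show ?case by (simp add: formula_of_Nil cost_def clauses_of_def)
next
  case (Cons a ws)
  obtain D w where a: "a = (D, w)" by force
  let ?f = "\<lambda>C. if C = D \<and> \<not> tautology D then w else 0"
  have sub: "clauses_of ?f \<subseteq> {D}" by (auto simp: clauses_of_def split: if_splits)
  have "cost ?f X = (if falsifies X D then w else 0)"
    using falsifies_not_tautology[of X D] by (simp add: cost_superset[OF _ sub])
  then show ?case
    using Cons finite_subset[OF sub]
    by (simp add: a formula_of_Cons cost_add finite_clauses_of_formula_of)
qed

lemma lit_true_neg [simp]: "lit_true X (neg l) \<longleftrightarrow> \<not> lit_true X l"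
  by (cases l) auto

text \<open>If \<open>X\<close> falsifies \<open>E\<close>, the only clause of the chain that it can
  falsify is the one negating the first literal of \<open>L\<close> true under
  \<open>X\<close>.\<close>

lemma sum_or_not:
  "(\<Sum>(D, w) \<leftarrow> or_not E L u. if falsifies X D then w else 0) =
   (if falsifies X E \<and> \<not> falsifies X (set L) then u else 0)"
  by (induction E L u rule: or_not.induct) (auto simp: falsifies_def)

lemma falsifies_insert: "falsifies X (insert l C) \<longleftrightarrow> \<not> lit_true X l \<and> falsifies X C"
  by (auto simp: falsifies_def)

lemma falsifies_Un: "falsifies X (C \<union> D) \<longleftrightarrow> falsifies X C \<and> falsifies X D"
  by (auto simp: falsifies_def)

text \<open>For the residual weights of a resolution. When both weights are infinite this rests on
  \<infinity> - \<infinity> = \<infinity>.\<close>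

lemma ereal_diff_min_add:
  fixes v w :: ereal
  assumes "v > 0" "w > 0"
  shows "min v w + (v - min v w) = v" "min v w + (w - min v w) = w"
    "(v - min v w) + min v w = v" "(w - min v w) + min v w = w"
  using assms by (cases v; cases w; auto simp: min_def)+

text \<open>For resolution, only the antecedent whose literal of \<open>x\<close> is false matters.
  If its side disjunction is falsified too, then either the resolvent or exactly one clause of its
  chain is falsified, which gives back the weight \<open>m\<close> taken from it.\<close>

lemma ressv_rule_cost:
  assumes "ressv_rule ants cons"
  shows "cost (formula_of cons) X = cost (formula_of ants) X"
  using assms
proof cases
  case (resolution v w m x A B)
  then show ?thesis
    by (cases "X x"; cases "falsifies X (set A)"; cases "falsifies X (set B)")
       (simp_all add: cost_formula_of sum_or_not falsifies_insert falsifies_Un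
         ereal_diff_min_add)
next
  case (split w A x)
  then show ?thesis
    by (cases "X x") (simp_all add: cost_formula_of falsifies_insert)
next
  case (virtual A w)
  then show ?thesis
    by (simp add: cost_formula_of)
qed

section \<open>Well-formedness and cost along derivations\<close>

lemma formula_of_neq_MInf:
  assumes "\<forall>(D, w) \<in> set ws. w \<noteq> -\<infinity>"
  shows "formula_of ws C \<noteq> -\<infinity>"
  using assms by (induction ws) (auto simp: formula_of_Nil formula_of_Cons split: if_splits)

lemma or_not_finite:
  assumes "finite E" "(D, w) \<in> set (or_not E L u)"
  shows "finite D \<and> w = u"
  using assms by (induction E L u rule: or_not.induct) auto

lemma ressv_rule_cons:
  assumes "ressv_rule ants cons" "\<forall>(D, w) \<in> set ants. finite D" "(D, w) \<in> set cons"
  shows "finite D \<and> w \<noteq> -\<infinity>"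
  using assms(1)
proof cases
  case (resolution v u m x A B)
  have "v - m \<noteq> -\<infinity>" "u - m \<noteq> -\<infinity>" "m \<noteq> -\<infinity>"
    using resolution(3-5) by (cases v; cases u; auto simp: min_def)+
  then show ?thesis
    using resolution assms(2,3) by (auto dest!: or_not_finite[rotated])
qed (use assms(2,3) in auto)

lemma ressv_rule_ants_pos: "ressv_rule ants cons \<Longrightarrow> (D, w) \<in> set ants \<Longrightarrow> w > 0"
  by (cases rule: ressv_rule.cases) auto

lemma formula_of_pos:
  assumes "\<forall>(D, w) \<in> set ws. w > 0" "(C, w) \<in> set ws" "\<not> tautology C"
  shows "formula_of ws C > 0"
proof -
  have nonneg: "formula_of us C \<ge> 0" if "\<forall>(D, w) \<in> set us. w > 0" for us
    using that by (induction us) (auto simp: formula_of_Nil formula_of_Cons)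
  show ?thesis
    using assms
  proof (induction ws)
    case (Cons a ws)
    obtain E u where a: "a = (E, u)" by force
    show ?case
    proof (cases "a = (C, w)")
      case True
      then show ?thesis
        using Cons.prems nonneg[of ws] by (auto simp: formula_of_Cons add_pos_nonneg)
    next
      case False
      then show ?thesis
        using Cons by (auto simp: a formula_of_Cons intro: add_pos_pos)
    qed
  qed auto
qed

lemma ressv_step_sound:
  assumes "ressv_step F F'" "weighted_formula F"
  shows "weighted_formula F' \<and> cost F' X = cost F X"
  using assms(1)
proof cases
  case (1 R ants cons)
  have R: "finite (clauses_of R)" "\<And>C. R C \<noteq> 0 \<Longrightarrow> finite C \<and> \<not> tautology C"
      "\<And>C. R C \<noteq> -\<infinity>"
    using 1(3) by (force simp: weighted_formula_def clauses_of_def)+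
  \<comment> \<open>An antecedent occurs in \<open>R\<close> or, when \<open>R C = 0\<close>, has
    positive weight in \<open>F\<close>. Either way a weighted formula contains it, so it is
    finite.\<close>
  have "finite C" if "(C, w) \<in> set ants" for C w
  proof (cases "R C = 0")
    case True
    have "formula_of ants C > 0"
      using formula_of_pos[OF _ that] that 1(4,5) ressv_rule_ants_pos by fast
    then have "F C \<noteq> 0" using True 1(1) by auto
    then show ?thesis using assms(2) by (auto simp: weighted_formula_def clauses_of_def)
  qed (use R in auto)
  then have cons: "finite D \<and> w \<noteq> -\<infinity>" if "(D, w) \<in> set cons" for D w
    using ressv_rule_cons[OF 1(4) _ that] by blast
  have sub: "clauses_of F' \<subseteq> clauses_of R \<union> clauses_of (formula_of cons)"
    by (auto simp: 1(2) clauses_of_def)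
  have "finite C \<and> \<not> tautology C" if "C \<in> clauses_of F'" for C
  proof (cases "R C = 0")
    case True
    then have "C \<in> clauses_of (formula_of cons)"
      using that by (simp add: 1(2) clauses_of_def)
    then show ?thesis using clauses_of_formula_of[of cons] cons by fastforce
  qed (use R(2) in auto)
  moreover have "F' C \<noteq> -\<infinity>" for C
    using R(3)[of C] formula_of_neq_MInf[of cons C] cons by (auto simp: 1(2))
  ultimately have "weighted_formula F'"
    using R(1) finite_subset[OF sub]
    by (simp add: weighted_formula_def finite_clauses_of_formula_of)
  moreover have "cost F' X = cost F X"
    using R(1) ressv_rule_cost[OF 1(4)]
    by (simp add: 1(1,2) cost_add finite_clauses_of_formula_of)
  ultimately show ?thesis ..
qed

lemma ressv_derivation_sound:
  assumes "ressv_derivation F F'" "weighted_formula F"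
  shows "weighted_formula F' \<and> cost F' X = cost F X"
  using assms by (induction rule: rtranclp_induct) (use ressv_step_sound in \<open>force+\<close>)

section \<open>Exchanging weights\<close>

fun var :: "'v literal \<Rightarrow> 'v" where
  "var (Pos x) = x"
| "var (Neg x) = x"

definition clauses_over :: "'v set \<Rightarrow> 'v clause set" where
  "clauses_over V = {C. var ` C \<subseteq> V \<and> \<not> tautology C}"

text \<open>These stand for the truth assignments on \<open>V\<close>: each is falsified by exactly
  one of them.\<close>

definition full_clauses :: "'v set \<Rightarrow> 'v clause set" where
  "full_clauses V = {C. var ` C = V \<and> \<not> tautology C}"

definition formula_over :: "'v set \<Rightarrow> 'v formula \<Rightarrow> bool" where
  "formula_over V F \<longleftrightarrow> clauses_of F \<subseteq> clauses_over V \<and> (\<forall>C. F C \<noteq> -\<infinity>)"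

text \<open>Quantifying over all formulas over \<open>V\<close> makes these changes composable. This
  is possible because weights may become negative; real values of \<open>f\<close> keep infinite
  weights intact.\<close>

definition shiftable :: "'v set \<Rightarrow> ('v clause \<Rightarrow> real) \<Rightarrow> bool" where
  "shiftable V f \<longleftrightarrow> (\<forall>C. f C \<noteq> 0 \<longrightarrow> C \<in> clauses_over V) \<and>
     (\<forall>F. formula_over V F \<longrightarrow> ressv_derivation F (\<lambda>C. F C + ereal (f C)))"

section \<open>Clauses over a finite set of variables\<close>

lemma literals_over: "{l. var l \<in> V} = Pos ` V \<union> Neg ` V"
proof -
  have "l \<in> Pos ` V \<union> Neg ` V" if "var l \<in> V" for l
    using that by (cases l) auto
  then show ?thesis by auto
qed

lemma finite_clauses_over: "finite V \<Longrightarrow> finite (clauses_over V)"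
  by (rule finite_subset[of _ "Pow {l. var l \<in> V}"]) (auto simp: clauses_over_def, auto simp: literals_over)

lemma finite_in_clauses_over: "finite V \<Longrightarrow> C \<in> clauses_over V \<Longrightarrow> finite C"
  by (rule finite_subset[of _ "{l. var l \<in> V}"]) (auto simp: clauses_over_def, auto simp: literals_over)

lemma formula_over_weighted: "finite V \<Longrightarrow> formula_over V F \<Longrightarrow> weighted_formula F"
  using finite_clauses_over[of V] finite_in_clauses_over[of V]
  by (auto simp: weighted_formula_def formula_over_def clauses_over_def intro: finite_subset)

lemma formula_over_add_real:
  "formula_over V F \<Longrightarrow> (\<And>C. f C \<noteq> 0 \<Longrightarrow> C \<in> clauses_over V) \<Longrightarrow>
   formula_over V (\<lambda>C. F C + ereal (f C))"
  by (force simp: formula_over_def clauses_of_def)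

lemma tautology_insert:
  "var l \<notin> var ` A \<Longrightarrow> tautology (insert l A) \<longleftrightarrow> tautology A"
proof -
  assume l: "var l \<notin> var ` A"
  have n: "var (neg k) = var k" "neg k \<noteq> k" "neg k = l \<longleftrightarrow> neg l = k" for k
    by (cases k; cases l; auto)+
  have "neg l \<notin> A" using l n(1) by (metis imageI)
  then show ?thesis
    using l n by (auto simp: tautology_def)
qed

lemma clauses_over_insert:
  "A \<in> clauses_over V \<Longrightarrow> var l \<in> V \<Longrightarrow> var l \<notin> var ` A \<Longrightarrow> insert l A \<in> clauses_over V"
  by (auto simp: clauses_over_def tautology_insert)

text \<open>Each clause of the chain negates a literal that \<open>E\<close> already contains.
  Resolving two extensions of the same clause therefore leaves no chain.\<close>

lemma or_not_tautology:
  assumes "set L \<subseteq> E" "(D, w) \<in> set (or_not E L u)"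
  shows "tautology D"
  using assms
proof (induction E L u rule: or_not.induct)
  case (2 E l L u)
  then show ?case by (auto simp: tautology_def insert_absorb)
qed auto

lemma formula_of_or_not_tautology:
  assumes "set L \<subseteq> E"
  shows "formula_of (or_not E L u) = (\<lambda>C. 0)"
proof
  fix C
  show "formula_of (or_not E L u) C = 0"
    using clauses_of_formula_of[of "or_not E L u"] or_not_tautology[OF assms]
    by (force simp: clauses_of_def)
qed

text \<open>The instance of resolution that undoes a split; at weight \<open>\<infinity>\<close> the antecedents survive.\<close>

lemma ressv_rule_unsplit:
  assumes "finite A" "w > 0"
  obtains cons where
    "ressv_rule [(insert (Pos x) A, w), (insert (Neg x) A, w)] cons"
    "formula_of cons =
      formula_of [(A, w), (insert (Pos x) A, w - w), (insert (Neg x) A, w - w)]"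
proof -
  obtain L where L: "set L = A" using finite_list[OF assms(1)] by blast
  show ?thesis
    using that resolution[OF assms(2,2) refl, of x L L]
    by (simp add: L formula_of_Cons formula_of_append formula_of_or_not_tautology subset_insertI
        formula_of_Nil)
qed

lemma shiftable_split:
  assumes V: "finite V" and A: "A \<in> clauses_over V" and x: "x \<in> V" "x \<notin> var ` A"
  shows "shiftable V (\<lambda>C. r * (of_bool (C = insert (Pos x) A) + of_bool (C = insert (Neg x) A)
                          - of_bool (C = A)))" (is "shiftable V ?f")
proof -
  let ?P = "insert (Pos x) A" and ?N = "insert (Neg x) A"
  have P: "?P \<in> clauses_over V" and N: "?N \<in> clauses_over V"
    using A x by (auto intro!: clauses_over_insert)
  have ne: "?P \<noteq> A" "?N \<noteq> A" "?P \<noteq> ?N" "A \<noteq> ?P" "A \<noteq> ?N" "?N \<noteq> ?P"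
    using x by (force simp: insert_eq_iff)+
  have nt: "\<not> tautology A" "\<not> tautology ?P" "\<not> tautology ?N"
    using A P N by (auto simp: clauses_over_def)
  have "ressv_derivation F (\<lambda>C. F C + ereal (?f C))" if F: "formula_over V F" for F
  proof -
    \<comment> \<open>With \<open>s\<close> real, subtracting and adding back is harmless even where
      \<open>F C\<close> is infinite.\<close>
    have cancel: "F C - ereal s + ereal s = F C" for C s
      by (cases "F C") auto
    consider "r = 0" | "r > 0" | "r < 0" by linarith
    then show ?thesis
    proof cases
      case 1
      then show ?thesis by (simp add: zero_ereal_def[symmetric])
    next
      case 2
      \<comment> \<open>\<open>F\<close> is unmerged at \<open>A\<close> into an antecedent of
        weight \<open>r\<close> and this remainder, which is negative there when
        \<open>F A < r\<close>.\<close>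
      define R where "R C = F C + ereal (- r * of_bool (C = A))" for C
      have "formula_over V R"
        unfolding R_def using A by (intro formula_over_add_real[OF F]) (auto split: if_splits)
      then have "ressv_step (\<lambda>C. R C + formula_of [(A, ereal r)] C)
          (\<lambda>C. R C + formula_of [(?P, ereal r), (?N, ereal r)] C)"
        using 2 nt by (intro ressv_step.intros split formula_over_weighted[OF V]) auto
      moreover have "(\<lambda>C. R C + formula_of [(A, ereal r)] C) = F"
        using nt cancel[of _ r] by (auto simp: R_def formula_of_Cons formula_of_Nil
            minus_ereal_def fun_eq_iff zero_ereal_def[symmetric])
      moreover have "(\<lambda>C. R C + formula_of [(?P, ereal r), (?N, ereal r)] C)
          = (\<lambda>C. F C + ereal (?f C))"
        using nt ne by (auto simp: R_def formula_of_Cons formula_of_Nil fun_eq_iff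
            zero_ereal_def[symmetric])
      ultimately show ?thesis by (metis r_into_rtranclp)
    next
      case 3
      define s where "s = - r"
      have s: "s > 0" "r = - s" using 3 by (auto simp: s_def)
      \<comment> \<open>Here \<open>s\<close> is separated from both extensions. Since
        \<open>s - s = 0\<close>, their resolution leaves only \<open>A\<close> with weight
        \<open>s\<close>.\<close>
      define R where "R C = F C + ereal (- s * (of_bool (C = ?P) + of_bool (C = ?N)))" for C
      obtain cons where cons: "ressv_rule [(?P, ereal s), (?N, ereal s)] cons"
        "formula_of cons = formula_of [(A, ereal s), (?P, ereal s - ereal s), (?N, ereal s - ereal s)]"
        using ressv_rule_unsplit[of A "ereal s" x] finite_in_clauses_over[OF V A] s by auto
      have "formula_over V R"
        unfolding R_def using P N
        by (intro formula_over_add_real[OF F]) (auto simp: of_bool_def split: if_splits)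
      then have "ressv_step (\<lambda>C. R C + formula_of [(?P, ereal s), (?N, ereal s)] C)
          (\<lambda>C. R C + formula_of cons C)"
        using nt by (intro ressv_step.intros cons(1) formula_over_weighted[OF V]) auto
      moreover have "(\<lambda>C. R C + formula_of [(?P, ereal s), (?N, ereal s)] C) = F"
        using nt ne cancel[of _ s] by (auto simp: R_def formula_of_Cons formula_of_Nil
            minus_ereal_def fun_eq_iff zero_ereal_def[symmetric])
      moreover have "(\<lambda>C. R C + formula_of cons C) = (\<lambda>C. F C + ereal (?f C))"
        using nt ne by (auto simp: R_def cons(2) formula_of_Cons formula_of_Nil fun_eq_iff
            zero_ereal_def[symmetric] s(2))
      ultimately show ?thesis by (metis r_into_rtranclp)
    qed
  qed
  then show ?thesis
    using A P N by (auto simp: shiftable_def split: if_splits)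
qed

section \<open>Sums of weight changes\<close>

lemma shiftable_zero: "shiftable V (\<lambda>C. 0)"
  by (simp add: shiftable_def zero_ereal_def[symmetric])

lemma shiftable_add:
  assumes "shiftable V f" "shiftable V g"
  shows "shiftable V (\<lambda>C. f C + g C)"
proof -
  have "ressv_derivation F (\<lambda>C. F C + ereal (f C + g C))" if F: "formula_over V F" for F
  proof -
    have "ressv_derivation F (\<lambda>C. F C + ereal (f C))"
      using assms(1) F by (auto simp: shiftable_def)
    also have "ressv_derivation \<dots> (\<lambda>C. F C + ereal (f C) + ereal (g C))"
      using assms formula_over_add_real[OF F, of f] by (auto simp: shiftable_def)
    finally show ?thesis by (simp add: add.assoc)
  qed
  moreover have "C \<in> clauses_over V" if "f C + g C \<noteq> 0" for C
    using assms that unfolding shiftable_def by (metis add_0)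
  ultimately show ?thesis by (auto simp: shiftable_def)
qed

lemma shiftable_sum:
  assumes "finite S" "\<And>i. i \<in> S \<Longrightarrow> shiftable V (f i)"
  shows "shiftable V (\<lambda>C. \<Sum>i\<in>S. f i C)"
  using assms by (induction S) (auto intro: shiftable_zero shiftable_add)

section \<open>Full clauses and the transfer of weights to them\<close>

lemma full_clauses_insert_iff:
  assumes "C \<in> full_clauses V" "x \<in> V"
  shows "Pos x \<in> C \<longleftrightarrow> Neg x \<notin> C"
proof -
  obtain l where "l \<in> C" "var l = x" using assms by (auto simp: full_clauses_def)
  then show ?thesis
    using assms(1) by (cases l) (force simp: full_clauses_def tautology_def)+
qed

lemma full_clauses_subset_eq:
  assumes "A \<in> full_clauses V" "C \<in> full_clauses V" "A \<subseteq> C"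
  shows "A = C"
proof -
  have "l \<in> A" if "l \<in> C" for l
  proof -
    have "var l \<in> V" using that assms(2) by (auto simp: full_clauses_def)
    then show ?thesis
      using full_clauses_insert_iff[OF assms(1)] full_clauses_insert_iff[OF assms(2)] that assms(3)
      by (cases l) auto
  qed
  then show ?thesis using assms(3) by auto
qed

text \<open>Clauses over \<open>V\<close> form a binary tree under splitting, with the full clauses as leaves.\<close>

lemma clauses_over_induct [consumes 2, case_names full split]:
  assumes "finite V" "A \<in> clauses_over V"
    and full: "\<And>A. A \<in> full_clauses V \<Longrightarrow> P A"
    and split: "\<And>A x. A \<in> clauses_over V \<Longrightarrow> x \<in> V \<Longrightarrow> x \<notin> var ` A \<Longrightarrow>
      P (insert (Pos x) A) \<Longrightarrow> P (insert (Neg x) A) \<Longrightarrow> P A"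
  shows "P A"
  using assms(2)
proof (induction "card (V - var ` A)" arbitrary: A rule: less_induct)
  case less
  show ?case
  proof (cases "V \<subseteq> var ` A")
    case True
    then show ?thesis
      using less.prems by (intro full) (auto simp: clauses_over_def full_clauses_def)
  next
    case False
    then obtain x where x: "x \<in> V" "x \<notin> var ` A" by auto
    have "P (insert l A)" if "var l = x" for l
      using that x less.prems assms(1)
      by (intro less.hyps clauses_over_insert psubset_card_mono) auto
    then show ?thesis using split[OF less.prems x] by simp
  qed
qed

text \<open>One split passes \<open>r\<close> from \<open>A\<close> to both extensions, and by
  induction these pass it on to the full clauses above them; the intermediate terms
  telescope.\<close>

lemma shiftable_full:
  assumes "finite V" "A \<in> clauses_over V"
  shows "shiftable V (\<lambda>C. r * (of_bool (C \<in> full_clauses V \<and> A \<subseteq> C) - of_bool (C = A)))"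
  using assms
proof (induction rule: clauses_over_induct)
  case (full A)
  then have "C \<in> full_clauses V \<and> A \<subseteq> C \<longleftrightarrow> C = A" for C
    using full_clauses_subset_eq by blast
  then show ?case using shiftable_zero by simp
next
  case (split A x)
  \<comment> \<open>A full clause above \<open>A\<close> contains exactly one of
    \<open>Pos x\<close> and \<open>Neg x\<close>, so it lies above exactly one extension.\<close>
  have "of_bool (C \<in> full_clauses V \<and> A \<subseteq> C) =
      (of_bool (C \<in> full_clauses V \<and> insert (Pos x) A \<subseteq> C)
      + of_bool (C \<in> full_clauses V \<and> insert (Neg x) A \<subseteq> C) :: real)" for C
    using full_clauses_insert_iff[OF _ split(2), of C] by auto
  then show ?case
    using shiftable_add[OF shiftable_split[OF assms(1) split(1-3), of r]
        shiftable_add[OF split(4,5)]]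
    by (simp add: algebra_simps)
qed

text \<open>Superposition of the transfers of \<open>g A\<close> from every \<open>A\<close> over
  \<open>V\<close>. A full clause gives away its own \<open>g C\<close> but gets it back as the term
  \<open>A = C\<close> of the sum.\<close>

lemma shiftable_to_full:
  assumes "finite V"
  shows "shiftable V (\<lambda>C. of_bool (C \<in> full_clauses V) * (\<Sum>A | A \<in> clauses_over V \<and> A \<subseteq> C. g A)
    - of_bool (C \<in> clauses_over V) * g C)"
proof -
  let ?S = "clauses_over V"
  have fin: "finite ?S" using assms by (rule finite_clauses_over)
  have "shiftable V (\<lambda>C. \<Sum>A\<in>?S. g A * (of_bool (C \<in> full_clauses V \<and> A \<subseteq> C) - of_bool (C = A)))"
    using fin shiftable_full[OF assms] by (rule shiftable_sum)
  moreover have "(\<Sum>A\<in>?S. g A * (of_bool (C \<in> full_clauses V \<and> A \<subseteq> C) - of_bool (C = A))) =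
      of_bool (C \<in> full_clauses V) * (\<Sum>A | A \<in> ?S \<and> A \<subseteq> C. g A) - of_bool (C \<in> ?S) * g C" for C
  proof -
    have "(\<Sum>A\<in>?S. g A * of_bool (C \<in> full_clauses V \<and> A \<subseteq> C)) =
        of_bool (C \<in> full_clauses V) * (\<Sum>A | A \<in> ?S \<and> A \<subseteq> C. g A)"
      using fin by (simp add: sum.inter_filter of_bool_def if_distrib cong: if_cong)
    moreover have "(\<Sum>A\<in>?S. g A * of_bool (C = A)) = of_bool (C \<in> ?S) * g C"
      using fin by (simp add: of_bool_def if_distrib cong: if_cong)
    ultimately show ?thesis by (simp add: right_diff_distrib sum_subtractf)
  qed
  ultimately show ?thesis by simp
qed

section \<open>Saturation with infinite weights\<close>

lemma formula_over_add_infinity: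
  assumes "formula_over V F" "S \<subseteq> clauses_over V"
  shows "formula_over V (\<lambda>C. F C + (if C \<in> S then \<infinity> else 0))"
  using assms by (auto simp: formula_over_def clauses_of_def)

lemma exists_saturated:
  assumes V: "finite V" and F: "formula_over V F"
  obtains F' where "ressv_derivation F F'" "formula_over V F'"
    "\<And>A. A \<in> clauses_over V \<Longrightarrow>
      F' A = \<infinity> \<longleftrightarrow> (\<forall>C \<in> full_clauses V. A \<subseteq> C \<longrightarrow> F' C = \<infinity>)"
proof -
  define I where "I F' = {C \<in> clauses_over V. F' C = \<infinity>}" for F' :: "'a formula"
  let ?D = "\<lambda>F'. ressv_derivation F F' \<and> formula_over V F'"
  have fin: "finite (clauses_over V)" using V by (rule finite_clauses_over)
  \<comment> \<open>There are finitely many clauses over \<open>V\<close>, so the number of infinite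
    ones is bounded and attains a maximum.\<close>
  have "\<exists>F'. ?D F' \<and> (\<forall>F''. ?D F'' \<longrightarrow> card (I F'') \<le> card (I F'))"
    using F fin by (intro ex_has_greatest_nat[where b = "Suc (card (clauses_over V))"])
      (auto simp: I_def less_Suc_eq_le intro!: card_mono)
  then obtain F' where F': "ressv_derivation F F'" "formula_over V F'"
    and max: "\<And>F''. ressv_derivation F F'' \<Longrightarrow> formula_over V F'' \<Longrightarrow> card (I F'') \<le> card (I F')"
    by blast
  \<comment> \<open>Adding \<infinity> on \<open>S\<close> can only enlarge \<open>I\<close>; by
    maximality it does not, so the clauses of \<open>S\<close> were infinite already.\<close>
  have sat: "F' C = \<infinity>"
    if "ressv_step F' (\<lambda>C. F' C + (if C \<in> S then \<infinity> else 0))" "S \<subseteq> clauses_over V" "C \<in> S" for S C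
  proof -
    let ?F = "\<lambda>C. F' C + (if C \<in> S then \<infinity> else 0)"
    have "card (I ?F) \<le> card (I F')"
      using F' that by (intro max formula_over_add_infinity) auto
    moreover have "I F' \<subseteq> I ?F" by (auto simp: I_def)
    moreover have "finite (I ?F)" using fin by (auto simp: I_def)
    ultimately have "I F' = I ?F" by (intro card_seteq) auto
    moreover have "C \<in> I ?F" using that(2,3) by (auto simp: I_def)
    ultimately show ?thesis by (auto simp: I_def)
  qed
  have w: "weighted_formula F'" using formula_over_weighted[OF V F'(2)] .
  have iff: "F' A = \<infinity> \<longleftrightarrow> F' (insert (Pos x) A) = \<infinity> \<and> F' (insert (Neg x) A) = \<infinity>"
    if A: "A \<in> clauses_over V" and x: "x \<in> V" "x \<notin> var ` A" for A x
  proof -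
    let ?P = "insert (Pos x) A" and ?N = "insert (Neg x) A"
    have P: "?P \<in> clauses_over V" and N: "?N \<in> clauses_over V"
      using A x by (auto intro!: clauses_over_insert)
    have nt: "\<not> tautology A" "\<not> tautology ?P" "\<not> tautology ?N"
      using A P N by (auto simp: clauses_over_def)
    show ?thesis
    proof (intro iffI)
      assume inf: "F' A = \<infinity>"
      let ?g = "formula_of [(?P, \<infinity>), (?N, \<infinity>)]"
      have "?g = (\<lambda>C. if C \<in> {?P, ?N} then \<infinity> else 0)"
        using nt by (auto simp: formula_of_Cons formula_of_Nil)
      \<comment> \<open>The remainder is \<open>F'\<close> itself: the infinite weight of
        \<open>A\<close> absorbs the antecedent, so nothing is consumed.\<close>
      moreover have "ressv_step (\<lambda>C. F' C + formula_of [(A, \<infinity>)] C) (\<lambda>C. F' C + ?g C)"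
        using nt by (intro ressv_step.intros split w) auto
      moreover have "(\<lambda>C. F' C + formula_of [(A, \<infinity>)] C) = F'"
        using inf by (auto simp: formula_of_Cons formula_of_Nil)
      ultimately have "ressv_step F' (\<lambda>C. F' C + (if C \<in> {?P, ?N} then \<infinity> else 0))" by simp
      from sat[OF this] show "F' ?P = \<infinity> \<and> F' ?N = \<infinity>"
        using P N by blast
    next
      assume inf: "F' ?P = \<infinity> \<and> F' ?N = \<infinity>"
      \<comment> \<open>Likewise, resolving the two infinite extensions consumes nothing, and only
        the weight of \<open>A\<close> can change.\<close>
      obtain cons where cons: "ressv_rule [(?P, \<infinity>), (?N, \<infinity>)] cons"
        "formula_of cons = formula_of [(A, \<infinity>), (?P, \<infinity> - \<infinity>), (?N, \<infinity> - \<infinity>)]"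
        using ressv_rule_unsplit[of A \<infinity> x] finite_in_clauses_over[OF V A] by auto
      have "formula_of cons = (\<lambda>C. if C \<in> {A, ?P, ?N} then \<infinity> else 0)"
        using nt by (auto simp: cons(2) formula_of_Cons formula_of_Nil)
      moreover have "ressv_step (\<lambda>C. F' C + formula_of [(?P, \<infinity>), (?N, \<infinity>)] C)
          (\<lambda>C. F' C + formula_of cons C)"
        using nt by (intro ressv_step.intros cons(1) w) auto
      moreover have "(\<lambda>C. F' C + formula_of [(?P, \<infinity>), (?N, \<infinity>)] C) = F'"
        using inf by (auto simp: formula_of_Cons formula_of_Nil)
      ultimately have "ressv_step F' (\<lambda>C. F' C + (if C \<in> {A, ?P, ?N} then \<infinity> else 0))" by simp
      from sat[OF this] show "F' A = \<infinity>"
        using A P N by blast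
    qed
  qed
  \<comment> \<open>Descending the splitting tree turns the equivalence for one split into one about
    the leaves.\<close>
  have "F' A = \<infinity> \<longleftrightarrow> (\<forall>C \<in> full_clauses V. A \<subseteq> C \<longrightarrow> F' C = \<infinity>)"
    if "A \<in> clauses_over V" for A
    using V that
  proof (induction rule: clauses_over_induct)
    case (full A)
    then show ?case using full_clauses_subset_eq by blast
  next
    case (split A x)
    then show ?case
      using iff[OF split(1-3)] full_clauses_insert_iff[OF _ split(2)] by auto
  qed
  then show ?thesis using that F' by blast
qed

section \<open>Completeness\<close>

text \<open>Under this assignment a literal over \<open>V\<close> is false exactly when it belongs
  to \<open>C\<close>.\<close>

lemma falsifies_full_clause:
  assumes "C \<in> full_clauses V" "var ` B \<subseteq> V"
  shows "falsifies (\<lambda>x. Neg x \<in> C) B \<longleftrightarrow> B \<subseteq> C"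
proof -
  have "\<not> lit_true (\<lambda>x. Neg x \<in> C) l \<longleftrightarrow> l \<in> C" if "l \<in> B" for l
    using that assms(2) full_clauses_insert_iff[OF assms(1)] by (cases l) force+
  then show ?thesis by (auto simp: falsifies_def)
qed

text \<open>This turns entailment into an inequality between sums over the subclauses of each full
  clause.\<close>

lemma cost_full_clause:
  assumes "finite V" "formula_over V F" "C \<in> full_clauses V"
  shows "cost F (\<lambda>x. Neg x \<in> C) = (\<Sum>A | A \<in> clauses_over V \<and> A \<subseteq> C. F A)"
proof -
  have "cost F (\<lambda>x. Neg x \<in> C) =
      (\<Sum>A\<in>clauses_over V. if falsifies (\<lambda>x. Neg x \<in> C) A then F A else 0)"
    using assms by (intro cost_superset finite_clauses_over) (auto simp: formula_over_def)
  also have "\<dots> = (\<Sum>A\<in>clauses_over V. if A \<subseteq> C then F A else 0)"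
    using falsifies_full_clause[OF assms(3)] by (intro sum.cong) (auto simp: clauses_over_def)
  finally show ?thesis
    using finite_clauses_over[OF assms(1)] by (simp add: sum.inter_filter)
qed

lemma sum_eq_PInf_iff:
  fixes f :: "'a \<Rightarrow> ereal"
  assumes "finite S"
  shows "sum f S = \<infinity> \<longleftrightarrow> (\<exists>i\<in>S. f i = \<infinity>)"
  using assms by (simp add: sum_Pinfty)

lemma sum_ereal_finite:
  fixes f :: "'a \<Rightarrow> ereal"
  assumes "\<And>i. i \<in> S \<Longrightarrow> \<bar>f i\<bar> \<noteq> \<infinity>"
  shows "sum f S = ereal (\<Sum>i\<in>S. real_of_ereal (f i))"
  using assms by (simp add: sum_ereal[symmetric] ereal_real del: sum_ereal)

lemma ressv_complete:
  assumes V: "finite V" and F: "formula_over V F" and G: "formula_over V G" "maxsat_formula G"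
    and ent: "entails F G"
  shows "ressv_proves F G"
proof -
  obtain F' where F': "ressv_derivation F F'" "formula_over V F'"
    and inf: "\<And>A. A \<in> clauses_over V \<Longrightarrow>
      F' A = \<infinity> \<longleftrightarrow> (\<forall>C \<in> full_clauses V. A \<subseteq> C \<longrightarrow> F' C = \<infinity>)"
    using exists_saturated[OF V F] by metis
  have ent': "cost G X \<le> cost F' X" for X
    using ressv_derivation_sound[OF F'(1) formula_over_weighted[OF V F]] ent
    by (simp add: entails_def)
  have F'_MInf: "F' C \<noteq> -\<infinity>" for C
    using F'(2) by (auto simp: formula_over_def)
  have G_nonneg: "G C \<ge> 0" for C
    using G(2) by (cases "G C = 0") (auto simp: maxsat_formula_def clauses_of_def)
  have outside: "F' C = 0" "G C = 0" if "C \<notin> clauses_over V" for C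
    using that F'(2) G(1) by (auto simp: formula_over_def clauses_of_def)
  define below where "below C = {A. A \<in> clauses_over V \<and> A \<subseteq> C}" for C
  have fin: "finite (below C)" for C
    using finite_clauses_over[OF V] by (auto simp: below_def)
  have full_over: "C \<in> clauses_over V" if "C \<in> full_clauses V" for C
    using that by (auto simp: clauses_over_def full_clauses_def)
  have le: "sum G (below C) \<le> sum F' (below C)" if "C \<in> full_clauses V" for C
    using ent'[of "\<lambda>x. Neg x \<in> C"] that
    by (simp add: cost_full_clause[OF V] F' G below_def)
  \<comment> \<open>An infinite \<open>G A\<close> forces an infinite cost of \<open>F'\<close> at
    the assignment falsifying \<open>C\<close>, hence an infinite \<open>F' B\<close> with
    \<open>B \<subseteq> C\<close>; saturation passes it up to \<open>C\<close>.\<close>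
  have G_inf: "F' C = \<infinity>" if "C \<in> full_clauses V" "A \<in> below C" "G A = \<infinity>" for A C
  proof -
    have "sum G (below C) = \<infinity>" using that fin by (auto simp: sum_eq_PInf_iff)
    then have "sum F' (below C) = \<infinity>" using le[OF that(1)] by simp
    then obtain B where "B \<in> below C" "F' B = \<infinity>" using fin by (auto simp: sum_eq_PInf_iff)
    then show ?thesis using inf[of B] that(1) by (auto simp: below_def)
  qed
  \<comment> \<open>The amount to move from \<open>A\<close> to the full clauses so that
    \<open>G A\<close> stays behind. As \<open>real_of_ereal\<close> maps \<infinity> to 0, infinite
    weights contribute nothing.\<close>
  define g where "g A = real_of_ereal (F' A) - real_of_ereal (G A)" for A
  define H where "H C = F' C + ereal (of_bool (C \<in> full_clauses V) * sum g (below C)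
    - of_bool (C \<in> clauses_over V) * g C)" for C
  have shift: "shiftable V (\<lambda>C. of_bool (C \<in> full_clauses V) * sum g (below C)
    - of_bool (C \<in> clauses_over V) * g C)"
    using shiftable_to_full[OF V, of g] by (simp add: below_def)
  have "ressv_derivation F' H"
    using shift F'(2) unfolding shiftable_def H_def by blast
  then have FH: "ressv_derivation F H" using F'(1) by simp
  have H_over: "formula_over V H"
    unfolding H_def using shift by (intro formula_over_add_real F'(2)) (auto simp: shiftable_def)
  have GH: "G C \<le> H C" for C
  proof (cases "C \<in> clauses_over V \<and> F' C \<noteq> \<infinity>")
    case True
    then have C: "C \<in> clauses_over V" "F' C \<noteq> \<infinity>" by auto
    \<comment> \<open>Otherwise every full clause above \<open>C\<close> would be infinite by
      \<open>G_inf\<close>, and then \<open>C\<close> itself by saturation.\<close>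
    have "G C \<noteq> \<infinity>"
    proof
      assume "G C = \<infinity>"
      then have "\<forall>D \<in> full_clauses V. C \<subseteq> D \<longrightarrow> F' D = \<infinity>"
        using G_inf C(1) by (auto simp: below_def)
      then show False using inf C by blast
    qed
    then obtain f' g' where fg: "F' C = ereal f'" "G C = ereal g'"
      using C F'_MInf[of C] G_nonneg[of C] by (cases "F' C"; cases "G C") auto
    \<comment> \<open>A finite full clause ends up with \<open>G C\<close> plus this sum. By
      saturation and \<open>G_inf\<close> all weights of \<open>F'\<close> and \<open>G\<close>
      below it are finite, so \<open>le\<close> becomes an inequality of reals.\<close>
    have "sum g (below C) \<ge> 0" if full: "C \<in> full_clauses V"
    proof -
      have "\<bar>F' A\<bar> \<noteq> \<infinity>" "\<bar>G A\<bar> \<noteq> \<infinity>" if "A \<in> below C" for A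
        using inf[of A] G_inf[OF full that] C(2) full that F'_MInf[of A] G_nonneg[of A]
        by (auto simp: below_def)
      then show ?thesis
        using le[OF full] by (simp add: sum_ereal_finite g_def sum_subtractf)
    qed
    then show ?thesis
      using C(1) fg by (auto simp: H_def g_def)
  next
    case False
    \<comment> \<open>Outside \<open>clauses_over V\<close> all weights are 0, and an infinite
      \<open>F' C\<close> survives the finite change.\<close>
    then show ?thesis
      using outside[of C] full_over[of C] by (auto simp: H_def zero_ereal_def[symmetric])
  qed
  have "maxsat_formula H"
    using formula_over_weighted[OF V H_over] order_trans[OF G_nonneg GH]
    by (auto simp: maxsat_formula_def clauses_of_def less_le)
  moreover have "subformula G H"
    unfolding subformula_def clauses_of_def using GH G_nonneg by (metis antisym mem_Collect_eq)
  ultimately show ?thesis using FH by (auto simp: ressv_proves_def)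
qed

theorem theorem9:
  fixes F G F\<^sub>i :: "'v formula"
  assumes "maxsat_formula F"
    and "maxsat_formula G"
    and "entails F G"
    and "ressv_derivation F F\<^sub>i"
  shows "ressv_proves F\<^sub>i G"
proof -
  have sound: "weighted_formula F\<^sub>i \<and> cost F\<^sub>i X = cost F X" for X
    using ressv_derivation_sound[OF assms(4)] assms(1) by (simp add: maxsat_formula_def)
  have wG: "weighted_formula G" using assms(2) by (simp add: maxsat_formula_def)
  \<comment> \<open>The construction needs one finite set of variables for both formulas.\<close>
  define V where "V = var ` \<Union> (clauses_of F\<^sub>i \<union> clauses_of G)"
  have "finite V"
    using sound wG by (auto simp: V_def weighted_formula_def)
  moreover have "formula_over V F'"
    if "weighted_formula F'" "clauses_of F' \<subseteq> clauses_of F\<^sub>i \<union> clauses_of G" for F'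
  proof -
    have "F' C \<noteq> -\<infinity>" for C
      using that(1) by (cases "F' C = 0") (auto simp: weighted_formula_def clauses_of_def)
    then show ?thesis
      using that unfolding formula_over_def weighted_formula_def clauses_over_def V_def by blast
  qed
  then have "formula_over V F\<^sub>i" "formula_over V G" using sound wG by auto
  \<comment> \<open>Derivations preserve cost, so entailment passes from \<open>F\<close> to
    \<open>F\<^sub>i\<close> even if the latter has negative weights.\<close>
  moreover have "entails F\<^sub>i G"
    using assms(3) sound by (simp add: entails_def)
  ultimately show ?thesis
    using ressv_complete assms(2) by blast
qed

end
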